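(* For every $\epsilon>0$ there exist a quadratic problem, namely a function $F(\theta)=\frac12(\theta-\mu^\star)^\top\mathbf{A}(\theta-\mu^\star)$ on some $\mathbb{R}^d$ with $\mathbf{A}$ diagonal positive definite, with stochastic gradients $g_k=\mathbf{A}(\theta_k-\mu^\star)+\xi_k$ (the $\xi_k$ i.i.d., zero mean, with nonzero diagonal covariance) and a learning rate $\eta>0$, and a choice of a diagonal matrix $\mathbf{C}$ with entries in $[0,1]$ and of $\beta\in(0,1)$, such that the limiting squared error $\lim_{T\to\infty}\mathbb{E}[\|\widehat{\theta}_{\mathrm{EMA},T}-\mu^\star\|^2]$ of the iterate-average estimator produced by $$\theta_{k+1}=\theta_k-\eta\,g_k+\mathbf{C}\left(\widehat{\theta}_{\mathrm{EMA},k}-\theta_k\right),\qquad \widehat{\theta}_{\mathrm{EMA},k+1}=(1-\beta)\widehat{\theta}_{\mathrm{EMA},k}+\beta\,\theta_{k+1}$$ is at most $\epsilon$ times the limiting squared error of the iterate-average estimator returned by SGD.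
   Context: The iterate-average estimator returned by SGD is the exponential moving average, with the same $\eta$ and $\beta$, of the plain SGD iterates, i.e. $\widehat{\theta}_{\mathrm{EMA},T}$ for the recursion with $\mathbf{C}=0$ on the same problem; its limiting squared error is $\lim_{T\to\infty}\mathbb{E}[\|\widehat{\theta}_{\mathrm{EMA},T}-\mu^\star\|^2]$ for that recursion. The processes are started from deterministic initial values. $\|\cdot\|$ is the Euclidean norm. *)

theory Defs
  imports "HOL-Probability.Probability" "Jordan_Normal_Form.Matrix"
begin

no_notation vec_nth (infixl "$" 90)
no_notation inner (infix "\<bullet>" 70)

text \<open>
  The dimension is existentially quantified in the claim, so vectors and matrices have an explicit
  dimension (\<^term>\<open>carrier_vec d\<close>, \<^term>\<open>carrier_mat d d\<close>) rather than a dimension type.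
\<close>

definition vec_norm :: "real vec \<Rightarrow> real" where
  "vec_norm v = L2_set (\<lambda>i. v $ i) {..<dim_vec v}"

definition positive_definite :: "nat \<Rightarrow> real mat \<Rightarrow> bool" where
  "positive_definite d A \<longleftrightarrow> A \<in> carrier_mat d d \<and> transpose_mat A = A \<and>
     (\<forall>v \<in> carrier_vec d. v \<noteq> 0\<^sub>v d \<longrightarrow> v \<bullet> (A *\<^sub>v v) > 0)"

definition quadratic_problem ::
  "nat \<Rightarrow> (real vec \<Rightarrow> real) \<Rightarrow> real mat \<Rightarrow> real vec \<Rightarrow> bool" where
  "quadratic_problem d F A \<mu> \<longleftrightarrow>
     A \<in> carrier_mat d d \<and> diagonal_mat A \<and> positive_definite d A \<and> \<mu> \<in> carrier_vec d \<and>
     (\<forall>\<theta> \<in> carrier_vec d. F \<theta> = 1/2 * ((\<theta> - \<mu>) \<bullet> (A *\<^sub>v (\<theta> - \<mu>))))"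

text \<open>
  The Borel \<open>\<sigma>\<close>-algebra of \<open>\<real>\<^sup>d\<close>, transported to \<^term>\<open>carrier_vec d\<close>; see
  \<open>measurable_vec_borel_iff\<close> below.
\<close>

definition vec_borel :: "nat \<Rightarrow> real vec measure" where
  "vec_borel d = vimage_algebra (carrier_vec d) (\<lambda>v. \<lambda>i\<in>{..<d}. v $ i)
                   (Pi\<^sub>M {..<d} (\<lambda>_. borel))"

definition cov_mat :: "'a measure \<Rightarrow> nat \<Rightarrow> ('a \<Rightarrow> real vec) \<Rightarrow> real mat" where
  "cov_mat M d X = mat d d (\<lambda>(i, j).
     \<integral>\<omega>. (X \<omega> $ i - (\<integral>\<omega>'. X \<omega>' $ i \<partial>M)) * (X \<omega> $ j - (\<integral>\<omega>'. X \<omega>' $ j \<partial>M)) \<partial>M)"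

text \<open>
  Square integrability is what makes the covariance matrix exist; without it the Bochner integrals
  in \<^const>\<open>cov_mat\<close> would silently be \<open>0\<close>.
\<close>

definition gradient_noise :: "nat \<Rightarrow> 'a measure \<Rightarrow> (nat \<Rightarrow> 'a \<Rightarrow> real vec) \<Rightarrow> bool" where
  "gradient_noise d M \<xi> \<longleftrightarrow>
     prob_space M \<and>
     prob_space.indep_vars M (\<lambda>_. vec_borel d) \<xi> UNIV \<and>
     (\<forall>k. distr M (vec_borel d) (\<xi> k) = distr M (vec_borel d) (\<xi> 0)) \<and>
     (\<forall>k. \<forall>i<d. integrable M (\<lambda>\<omega>. (\<xi> k \<omega> $ i)\<^sup>2)) \<and>
     (\<forall>k. \<forall>i<d. integrable M (\<lambda>\<omega>. \<xi> k \<omega> $ i) \<and> (\<integral>\<omega>. \<xi> k \<omega> $ i \<partial>M) = 0) \<and>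
     (\<forall>k. diagonal_mat (cov_mat M d (\<xi> k)) \<and> cov_mat M d (\<xi> k) \<noteq> 0\<^sub>m d d)"

definition stoch_grad :: "real mat \<Rightarrow> real vec \<Rightarrow> real vec \<Rightarrow> real vec \<Rightarrow> real vec" where
  "stoch_grad A \<mu> \<theta> x = A *\<^sub>v (\<theta> - \<mu>) + x"

text \<open>
  The pair of the \<open>k\<close>-th iterate and the \<open>k\<close>-th exponential moving average, for the
  realisation \<open>x\<close> of the noise sequence and the initial values \<open>\<theta>\<^sub>0\<close>, \<open>m\<^sub>0\<close>.
\<close>

primrec ema_iter :: "real mat \<Rightarrow> real vec \<Rightarrow> real \<Rightarrow> real mat \<Rightarrow> real \<Rightarrow> real vec \<Rightarrow> real vec \<Rightarrow>
    (nat \<Rightarrow> real vec) \<Rightarrow> nat \<Rightarrow> real vec \<times> real vec" where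
  "ema_iter A \<mu> \<eta> C \<beta> \<theta>\<^sub>0 m\<^sub>0 x 0 = (\<theta>\<^sub>0, m\<^sub>0)"
| "ema_iter A \<mu> \<eta> C \<beta> \<theta>\<^sub>0 m\<^sub>0 x (Suc k) =
     (let (\<theta>, m) = ema_iter A \<mu> \<eta> C \<beta> \<theta>\<^sub>0 m\<^sub>0 x k;
          \<theta>' = \<theta> - \<eta> \<cdot>\<^sub>v stoch_grad A \<mu> \<theta> (x k) + C *\<^sub>v (m - \<theta>)
      in (\<theta>', (1 - \<beta>) \<cdot>\<^sub>v m + \<beta> \<cdot>\<^sub>v \<theta>'))"

definition ema_estimator :: "real mat \<Rightarrow> real vec \<Rightarrow> real \<Rightarrow> real mat \<Rightarrow> real \<Rightarrow> real vec \<Rightarrow>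
    real vec \<Rightarrow> (nat \<Rightarrow> real vec) \<Rightarrow> nat \<Rightarrow> real vec" where
  "ema_estimator A \<mu> \<eta> C \<beta> \<theta>\<^sub>0 m\<^sub>0 x T = snd (ema_iter A \<mu> \<eta> C \<beta> \<theta>\<^sub>0 m\<^sub>0 x T)"

text \<open>
  The limit is a real number, so a diverging error does not count, and it has to be the same for
  all deterministic initial values.
\<close>

definition has_limiting_sq_error :: "nat \<Rightarrow> 'a measure \<Rightarrow> (nat \<Rightarrow> 'a \<Rightarrow> real vec) \<Rightarrow> real mat \<Rightarrow>
    real vec \<Rightarrow> real \<Rightarrow> real mat \<Rightarrow> real \<Rightarrow> real \<Rightarrow> bool" where
  "has_limiting_sq_error d M \<xi> A \<mu> \<eta> C \<beta> L \<longleftrightarrow>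
     (\<forall>\<theta>\<^sub>0 \<in> carrier_vec d. \<forall>m\<^sub>0 \<in> carrier_vec d.
        (\<lambda>T. \<integral>\<omega>. (vec_norm (ema_estimator A \<mu> \<eta> C \<beta> \<theta>\<^sub>0 m\<^sub>0 (\<lambda>k. \<xi> k \<omega>) T - \<mu>))\<^sup>2 \<partial>M)
          \<longlonglongrightarrow> L)"

lemma measurable_vec_borel_iff:
  "X \<in> measurable M (vec_borel d) \<longleftrightarrow>
     (\<forall>\<omega> \<in> space M. X \<omega> \<in> carrier_vec d) \<and> (\<forall>i<d. (\<lambda>\<omega>. X \<omega> $ i) \<in> borel_measurable M)"
  (is "?L \<longleftrightarrow> ?R")
proof
  let ?f = "\<lambda>v::real vec. \<lambda>i\<in>{..<d}. v $ i"
  let ?P = "Pi\<^sub>M {..<d} (\<lambda>_. borel :: real measure)"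
  assume L: ?L
  have 1: "X \<omega> \<in> carrier_vec d" if "\<omega> \<in> space M" for \<omega>
    using measurable_space[OF L that] by (simp add: vec_borel_def)
  have "?f \<in> measurable (vec_borel d) ?P"
    unfolding vec_borel_def
    by (rule measurable_vimage_algebra1) (auto simp: space_PiM)
  from measurable_compose[OF L this] have "(\<lambda>\<omega>. ?f (X \<omega>)) \<in> measurable M ?P" .
  then have "(\<lambda>\<omega>. X \<omega> $ i) \<in> borel_measurable M" if "i < d" for i
    using measurable_compose[of "\<lambda>\<omega>. ?f (X \<omega>)" M ?P "\<lambda>g. g i" borel] that
      measurable_component_singleton[of i "{..<d}" "\<lambda>_. borel :: real measure"] by simp
  with 1 show ?R by auto
next
  assume R: ?R
  show ?L
    unfolding vec_borel_def
  proof (rule measurable_vimage_algebra2)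
    show "X \<in> space M \<rightarrow> carrier_vec d" using R by auto
    show "(\<lambda>\<omega>. \<lambda>i\<in>{..<d}. X \<omega> $ i) \<in> measurable M (Pi\<^sub>M {..<d} (\<lambda>_. borel))"
      using R by (intro measurable_restrict) auto
  qed
qed

lemma quadratic_problem_gradient:
  assumes F: "quadratic_problem d F A \<mu>" and \<theta>: "\<theta> \<in> carrier_vec d" and v: "v \<in> carrier_vec d"
  shows "((\<lambda>t. F (\<theta> + t \<cdot>\<^sub>v v)) has_real_derivative (A *\<^sub>v (\<theta> - \<mu>)) \<bullet> v) (at 0)"
proof -
  let ?w = "\<theta> - \<mu>"
  have A: "A \<in> carrier_mat d d" and \<mu>: "\<mu> \<in> carrier_vec d" and sym: "transpose_mat A = A"
    using F by (auto simp: quadratic_problem_def positive_definite_def)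
  have w: "?w \<in> carrier_vec d" using \<theta> \<mu> by simp
  have Aw: "A *\<^sub>v ?w \<in> carrier_vec d" and Av: "A *\<^sub>v v \<in> carrier_vec d"
    using A w v by auto
  have swap: "?w \<bullet> (A *\<^sub>v v) = (A *\<^sub>v ?w) \<bullet> v"
    using transpose_vec_mult_scalar[OF A v w] sym comm_scalar_prod[OF w Av] by simp
  have sw: "v \<bullet> (A *\<^sub>v ?w) = (A *\<^sub>v ?w) \<bullet> v" by (rule comm_scalar_prod[OF v Aw])
  have "F (\<theta> + t \<cdot>\<^sub>v v) =
      1/2 * (?w \<bullet> (A *\<^sub>v ?w)) + t * ((A *\<^sub>v ?w) \<bullet> v) + t\<^sup>2 * (1/2 * (v \<bullet> (A *\<^sub>v v)))" for t
  proof -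
    have eq: "\<theta> + t \<cdot>\<^sub>v v - \<mu> = ?w + t \<cdot>\<^sub>v v" using \<theta> \<mu> v by auto
    have "A *\<^sub>v (?w + t \<cdot>\<^sub>v v) = A *\<^sub>v ?w + t \<cdot>\<^sub>v (A *\<^sub>v v)"
      using mult_add_distrib_mat_vec[OF A w, of "t \<cdot>\<^sub>v v"] mult_mat_vec[OF A v] v by simp
    then have "(?w + t \<cdot>\<^sub>v v) \<bullet> (A *\<^sub>v (?w + t \<cdot>\<^sub>v v)) =
        ?w \<bullet> (A *\<^sub>v ?w) + t * (?w \<bullet> (A *\<^sub>v v)) + t * (v \<bullet> (A *\<^sub>v ?w)) + t * t * (v \<bullet> (A *\<^sub>v v))"
      using w v Aw Av
      by (simp add: add_scalar_prod_distrib[of _ d] scalar_prod_add_distrib[of _ d] algebra_simps)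
    moreover have "F (\<theta> + t \<cdot>\<^sub>v v) = 1/2 * ((?w + t \<cdot>\<^sub>v v) \<bullet> (A *\<^sub>v (?w + t \<cdot>\<^sub>v v)))"
      using F \<theta> v unfolding quadratic_problem_def eq[symmetric] by auto
    ultimately show ?thesis by (simp add: swap sw power2_eq_square algebra_simps)
  qed
  then show ?thesis by (auto intro!: derivative_eq_intros)
qed

end

theory Submission
  imports Defs
begin

text \<open>
  A one-dimensional problem suffices: curvature \<open>\<delta>\<close>, step size \<open>1\<close>, unit-variance
  noise and \<open>\<beta> = \<delta>\<close>. With \<open>C = 1 - \<delta>\<close> the dependence of \<open>\<theta>\<^sub>k\<^sub>+\<^sub>1\<close> on
  \<open>\<theta>\<^sub>k\<close> cancels, so the average is the AR(1) process
  \<open>m' = (1 - \<delta>\<^sup>2) m - \<delta> \<xi>\<close> with limiting variance \<open>1 / (2 - \<delta>\<^sup>2)\<close>. For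
  \<open>C = 0\<close> the second moments of \<open>(\<theta>, m)\<close> obey a triangular affine recursion, and
  the limiting variance of \<open>m\<close> is \<open>(1 + (1 - \<delta>)\<^sup>2) / (\<delta> (2 - \<delta>)\<^sup>3) \<ge> 1 / (8 \<delta>)\<close>.
  The ratio is \<open>O(\<delta>)\<close>.
\<close>

section \<open>Affine recursions\<close>

text \<open>Subtracting the fixed point \<open>l / (1 - q)\<close> leaves a contraction with a
  perturbation \<open>b n - l\<close> that tends to zero. Each second moment below obeys such a
  recursion, with an inhomogeneity that converges.\<close>

lemma affine_recursion_tendsto:
  fixes x b :: "nat \<Rightarrow> real"
  assumes rec: "\<And>n. x (Suc n) = q * x n + b n" and b: "b \<longlonglongrightarrow> l" and q: "\<bar>q\<bar> < 1"
  shows "x \<longlonglongrightarrow> l / (1 - q)"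
proof -
  define y where "y n = x n - l / (1 - q)" for n
  have q1: "1 - q \<noteq> 0" and q0: "0 < 1 - \<bar>q\<bar>" using q by auto
  have y_Suc: "y (Suc n) = q * y n + (b n - l)" for n
    using q1 by (simp add: y_def rec field_simps)
  have "y \<longlonglongrightarrow> 0"
  proof (rule LIMSEQ_I)
    fix e :: real assume e: "e > 0"
    \<comment> \<open>Chosen to satisfy \<open>\<bar>q\<bar> * (e / 2) + h = e / 2\<close>, so that
      the additive term \<open>e / 2\<close> in \<open>bound\<close> reproduces itself in the
      induction.\<close>
    define h where "h = e / 2 * (1 - \<bar>q\<bar>)"
    have "h > 0" using e q0 by (simp add: h_def)
    then obtain N where N: "\<And>n. n \<ge> N \<Longrightarrow> \<bar>b n - l\<bar> < h"
      using LIMSEQ_D[OF b] by (metis real_norm_def)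
    have bound: "\<bar>y (N + k)\<bar> \<le> \<bar>q\<bar> ^ k * \<bar>y N\<bar> + e / 2" for k
    proof (induction k)
      case (Suc k)
      have "\<bar>y (N + Suc k)\<bar> \<le> \<bar>q\<bar> * \<bar>y (N + k)\<bar> + \<bar>b (N + k) - l\<bar>"
        using abs_triangle_ineq[of "q * y (N + k)" "b (N + k) - l"] by (simp add: y_Suc abs_mult)
      also have "\<dots> \<le> \<bar>q\<bar> * (\<bar>q\<bar> ^ k * \<bar>y N\<bar> + e / 2) + h"
        using Suc N[of "N + k"] by (intro add_mono mult_left_mono) auto
      also have "\<dots> = \<bar>q\<bar> ^ Suc k * \<bar>y N\<bar> + e / 2"
        by (simp add: h_def field_simps)
      finally show ?case .
    qed (use e in simp)
    have "(\<lambda>k. \<bar>q\<bar> ^ k * \<bar>y N\<bar>) \<longlonglongrightarrow> 0"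
      using q by (intro tendsto_mult_left_zero LIMSEQ_power_zero) simp
    from LIMSEQ_D[OF this, of "e / 2"] e
    obtain K where K: "\<And>k. k \<ge> K \<Longrightarrow> \<bar>q\<bar> ^ k * \<bar>y N\<bar> < e / 2"
      by (auto simp: abs_mult)
    have "\<bar>y n\<bar> < e" if "n \<ge> N + K" for n
    proof -
      have "K \<le> n - N" "N + (n - N) = n" using that by auto
      then show ?thesis using bound[of "n - N"] K[of "n - N"] by simp
    qed
    then show "\<exists>no. \<forall>n\<ge>no. norm (y n - 0) < e" by auto
  qed
  then have "(\<lambda>n. y n + l / (1 - q)) \<longlonglongrightarrow> 0 + l / (1 - q)" by (intro tendsto_intros)
  then show ?thesis by (simp add: y_def)
qed

section \<open>Second moments of a linear recursion driven by white noise\<close>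

text \<open>The product is dominated through
  \<open>\<bar>a * b\<bar> \<le> a\<^sup>2 + b\<^sup>2\<close>.\<close>

lemma integrable_mult_of_squares:
  fixes f g :: "'a \<Rightarrow> real"
  assumes [measurable]: "f \<in> borel_measurable M" "g \<in> borel_measurable M"
    and "integrable M (\<lambda>x. (f x)\<^sup>2)" "integrable M (\<lambda>x. (g x)\<^sup>2)"
  shows "integrable M (\<lambda>x. f x * g x)"
proof (rule Bochner_Integration.integrable_bound)
  show "integrable M (\<lambda>x. (f x)\<^sup>2 + (g x)\<^sup>2)" using assms by simp
  have "\<bar>a * b\<bar> \<le> a\<^sup>2 + b\<^sup>2" for a b :: real
    using sum_squares_bound[of "\<bar>a\<bar>" "\<bar>b\<bar>"] abs_ge_zero[of "a * b"]
    unfolding power2_abs abs_mult by linarith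
  then show "AE x in M. norm (f x * g x) \<le> norm ((f x)\<^sup>2 + (g x)\<^sup>2)" by simp
qed simp

text \<open>\<open>X\<close> will be the iterate and \<open>Y\<close> its moving average. The
  equations are required on \<open>space M\<close> only, since the vector-valued noise is known to
  have the right dimension only there.\<close>

locale linear_pair = prob_space M for M :: "'a measure" +
  fixes X Y Z :: "nat \<Rightarrow> 'a \<Rightarrow> real" and x\<^sub>0 y\<^sub>0 a b s a' b' s' :: real
  assumes Z_meas [measurable]: "\<And>k. Z k \<in> borel_measurable M"
    and Z_sq: "\<And>k. integrable M (\<lambda>\<omega>. (Z k \<omega>)\<^sup>2)"
    and Z_mean: "\<And>k. expectation (Z k) = 0"
    and Z_var: "\<And>k. expectation (\<lambda>\<omega>. (Z k \<omega>)\<^sup>2) = 1"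
    and Z_uncorrelated: "\<And>j k. j \<noteq> k \<Longrightarrow> expectation (\<lambda>\<omega>. Z j \<omega> * Z k \<omega>) = 0"
    and X_0: "\<And>\<omega>. \<omega> \<in> space M \<Longrightarrow> X 0 \<omega> = x\<^sub>0"
    and Y_0: "\<And>\<omega>. \<omega> \<in> space M \<Longrightarrow> Y 0 \<omega> = y\<^sub>0"
    and X_Suc: "\<And>k \<omega>. \<omega> \<in> space M \<Longrightarrow> X (Suc k) \<omega> = a * X k \<omega> + b * Y k \<omega> + s * Z k \<omega>"
    and Y_Suc: "\<And>k \<omega>. \<omega> \<in> space M \<Longrightarrow> Y (Suc k) \<omega> = a' * X k \<omega> + b' * Y k \<omega> + s' * Z k \<omega>"
begin

lemma measurable_XY: "X n \<in> borel_measurable M \<and> Y n \<in> borel_measurable M"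
proof (induction n)
  case 0
  show ?case using X_0 Y_0 by (simp cong: measurable_cong)
next
  case (Suc n)
  then have [measurable]: "X n \<in> borel_measurable M" "Y n \<in> borel_measurable M" by auto
  show ?case
    using X_Suc Y_Suc by (simp cong: measurable_cong)
qed

lemmas measurable_X [measurable] = measurable_XY[THEN conjunct1]
lemmas measurable_Y [measurable] = measurable_XY[THEN conjunct2]

lemma integrable_combination_sq:
  assumes [measurable]: "f \<in> borel_measurable M" "g \<in> borel_measurable M"
    and "integrable M (\<lambda>\<omega>. (f \<omega>)\<^sup>2)" "integrable M (\<lambda>\<omega>. (g \<omega>)\<^sup>2)"
  shows "integrable M (\<lambda>\<omega>. (p * f \<omega> + q * g \<omega> + r * Z k \<omega>)\<^sup>2)"
proof -
  have "(\<lambda>\<omega>. (p * f \<omega> + q * g \<omega> + r * Z k \<omega>)\<^sup>2) =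
    (\<lambda>\<omega>. p\<^sup>2 * (f \<omega>)\<^sup>2 + q\<^sup>2 * (g \<omega>)\<^sup>2 + r\<^sup>2 * (Z k \<omega>)\<^sup>2 + (2 * p * q) * (f \<omega> * g \<omega>)
      + (2 * p * r) * (f \<omega> * Z k \<omega>) + (2 * q * r) * (g \<omega> * Z k \<omega>))"
    by (simp add: fun_eq_iff power2_eq_square algebra_simps)
  moreover have "integrable M (\<lambda>\<omega>. f \<omega> * g \<omega>)" "integrable M (\<lambda>\<omega>. f \<omega> * Z k \<omega>)"
      "integrable M (\<lambda>\<omega>. g \<omega> * Z k \<omega>)"
    using assms Z_sq by (simp_all add: integrable_mult_of_squares)
  ultimately show ?thesis using assms Z_sq by simp
qed

lemma integrable_XY_sq: "integrable M (\<lambda>\<omega>. (X n \<omega>)\<^sup>2) \<and> integrable M (\<lambda>\<omega>. (Y n \<omega>)\<^sup>2)"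
proof (induction n)
  case 0
  show ?case using X_0 Y_0 by (simp cong: Bochner_Integration.integrable_cong)
next
  case (Suc n)
  then show ?case
    using X_Suc Y_Suc
    by (simp add: integrable_combination_sq cong: Bochner_Integration.integrable_cong)
qed

lemma integrable_products:
  "integrable M (\<lambda>\<omega>. X n \<omega> * X n \<omega>)" "integrable M (\<lambda>\<omega>. X n \<omega> * Y n \<omega>)"
  "integrable M (\<lambda>\<omega>. Y n \<omega> * Y n \<omega>)" "integrable M (\<lambda>\<omega>. X n \<omega> * Z k \<omega>)"
  "integrable M (\<lambda>\<omega>. Y n \<omega> * Z k \<omega>)" "integrable M (\<lambda>\<omega>. Z j \<omega> * Z k \<omega>)"
  using integrable_XY_sq Z_sq by (simp_all add: integrable_mult_of_squares)

text \<open>\<open>X n\<close> and \<open>Y n\<close> are affine combinations of \<open>Z 0\<close>,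
  ..., \<open>Z (n - 1)\<close>, all uncorrelated with \<open>Z k\<close>. The case
  \<open>k = n\<close> belongs to the claim because \<open>Z n\<close> first enters at index
  \<open>Suc n\<close>.\<close>

lemma XY_orthogonal_Z:
  "k \<ge> n \<Longrightarrow> expectation (\<lambda>\<omega>. X n \<omega> * Z k \<omega>) = 0 \<and> expectation (\<lambda>\<omega>. Y n \<omega> * Z k \<omega>) = 0"
proof (induction n)
  case 0
  show ?case using X_0 Y_0 Z_mean by (simp cong: Bochner_Integration.integral_cong)
next
  case (Suc n)
  have step: "expectation (\<lambda>\<omega>. (p * X n \<omega> + q * Y n \<omega> + r * Z n \<omega>) * Z k \<omega>) = 0" for p q r
  proof -
    have "(\<lambda>\<omega>. (p * X n \<omega> + q * Y n \<omega> + r * Z n \<omega>) * Z k \<omega>) =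
      (\<lambda>\<omega>. p * (X n \<omega> * Z k \<omega>) + q * (Y n \<omega> * Z k \<omega>) + r * (Z n \<omega> * Z k \<omega>))"
      by (simp add: fun_eq_iff algebra_simps)
    then show ?thesis
      using Suc Z_uncorrelated[of n k] by (simp add: integrable_products)
  qed
  show ?case using X_Suc Y_Suc step by (simp cong: Bochner_Integration.integral_cong)
qed

text \<open>The mixed terms with \<open>Z n\<close> vanish by \<open>XY_orthogonal_Z\<close>, and
  the square of \<open>Z n\<close> has mean one. Two free coefficient triples let this one formula
  give all three moment recursions.\<close>

lemma expectation_product:
  "expectation (\<lambda>\<omega>. (p * X n \<omega> + q * Y n \<omega> + r * Z n \<omega>) * (p' * X n \<omega> + q' * Y n \<omega> + r' * Z n \<omega>)) =
    p * p' * expectation (\<lambda>\<omega>. X n \<omega> * X n \<omega>) + (p * q' + p' * q) * expectation (\<lambda>\<omega>. X n \<omega> * Y n \<omega>)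
    + q * q' * expectation (\<lambda>\<omega>. Y n \<omega> * Y n \<omega>) + r * r'"
proof -
  have "(\<lambda>\<omega>. (p * X n \<omega> + q * Y n \<omega> + r * Z n \<omega>) * (p' * X n \<omega> + q' * Y n \<omega> + r' * Z n \<omega>)) =
    (\<lambda>\<omega>. (p * p') * (X n \<omega> * X n \<omega>) + (p * q' + p' * q) * (X n \<omega> * Y n \<omega>)
      + (q * q') * (Y n \<omega> * Y n \<omega>) + (r * r') * (Z n \<omega> * Z n \<omega>)
      + (p * r' + p' * r) * (X n \<omega> * Z n \<omega>) + (q * r' + q' * r) * (Y n \<omega> * Z n \<omega>))"
    by (simp add: fun_eq_iff algebra_simps)
  then show ?thesis
    using XY_orthogonal_Z[of n n] Z_var[of n]
    by (simp add: integrable_products power2_eq_square)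
qed

section \<open>Closed system for the second moments and its limits\<close>

text \<open>The moments are uncentred: with the minimiser at the origin, \<open>EYY\<close> is the
  squared error itself, including the influence of the initial values.\<close>

definition "EXX = (\<lambda>n. expectation (\<lambda>\<omega>. X n \<omega> * X n \<omega>))"
definition "EXY = (\<lambda>n. expectation (\<lambda>\<omega>. X n \<omega> * Y n \<omega>))"
definition "EYY = (\<lambda>n. expectation (\<lambda>\<omega>. Y n \<omega> * Y n \<omega>))"

lemma EXX_Suc: "EXX (Suc n) = a\<^sup>2 * EXX n + 2 * a * b * EXY n + b\<^sup>2 * EYY n + s\<^sup>2"
  and EXY_Suc: "EXY (Suc n) = a * a' * EXX n + (a * b' + a' * b) * EXY n + b * b' * EYY n + s * s'"
  and EYY_Suc: "EYY (Suc n) = a'\<^sup>2 * EXX n + 2 * a' * b' * EXY n + b'\<^sup>2 * EYY n + s'\<^sup>2"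
  unfolding EXX_def EXY_def EYY_def using X_Suc Y_Suc
  by (simp_all add: expectation_product power2_eq_square cong: Bochner_Integration.integral_cong)

text \<open>With \<open>a' = 0\<close> the second process is an AR(1) process on its own, and the
  limit is its stationary variance.\<close>

lemma EYY_tendsto_autonomous:
  assumes "a' = 0" and "\<bar>b'\<bar> < 1"
  shows "EYY \<longlonglongrightarrow> s'\<^sup>2 / (1 - b'\<^sup>2)"
proof (rule affine_recursion_tendsto)
  show "EYY (Suc n) = b'\<^sup>2 * EYY n + s'\<^sup>2" for n using assms by (simp add: EYY_Suc)
  show "\<bar>b'\<^sup>2\<bar> < 1" using assms by (simp add: abs_square_less_1)
qed simp

text \<open>With \<open>b = 0\<close> the moments can be solved in turn: \<open>EXX\<close> is
  autonomous, \<open>EXY\<close> is driven by \<open>EXX\<close>, and \<open>EYY\<close> by both.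
  The contraction factors are \<open>a\<^sup>2\<close>, \<open>a * b'\<close> and
  \<open>b'\<^sup>2\<close>; \<open>u\<close> and \<open>v\<close> are the limits of
  \<open>EXX\<close> and \<open>EXY\<close>.\<close>

lemma EYY_tendsto_triangular:
  assumes "b = 0" and a: "\<bar>a\<bar> < 1" and b': "\<bar>b'\<bar> < 1"
  defines "u \<equiv> s\<^sup>2 / (1 - a\<^sup>2)"
  defines "v \<equiv> (a * a' * u + s * s') / (1 - a * b')"
  shows "EYY \<longlonglongrightarrow> (a'\<^sup>2 * u + 2 * a' * b' * v + s'\<^sup>2) / (1 - b'\<^sup>2)"
proof -
  have "EXX \<longlonglongrightarrow> u"
    unfolding u_def
  proof (rule affine_recursion_tendsto)
    show "EXX (Suc n) = a\<^sup>2 * EXX n + s\<^sup>2" for n using assms by (simp add: EXX_Suc)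
    show "\<bar>a\<^sup>2\<bar> < 1" using a by (simp add: abs_square_less_1)
  qed simp
  moreover have "EXY \<longlonglongrightarrow> v"
    unfolding v_def
  proof (rule affine_recursion_tendsto)
    show "EXY (Suc n) = a * b' * EXY n + (a * a' * EXX n + s * s')" for n
      using assms by (simp add: EXY_Suc)
    show "\<bar>a * b'\<bar> < 1" using abs_mult_less[OF a b'] by (simp add: abs_mult)
    show "(\<lambda>n. a * a' * EXX n + s * s') \<longlonglongrightarrow> a * a' * u + s * s'"
      using \<open>EXX \<longlonglongrightarrow> u\<close> by (intro tendsto_intros)
  qed
  ultimately show ?thesis
  proof (intro affine_recursion_tendsto)
    show "EYY (Suc n) = b'\<^sup>2 * EYY n + (a'\<^sup>2 * EXX n + 2 * a' * b' * EXY n + s'\<^sup>2)" for n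
      by (simp add: EYY_Suc)
    show "\<bar>b'\<^sup>2\<bar> < 1" using b' by (simp add: abs_square_less_1)
  qed (intro tendsto_intros)
qed

end

section \<open>Coordinates of the iteration\<close>

lemma diagonal_mult_vec_index:
  fixes A :: "'a :: semiring_0 mat"
  assumes "A \<in> carrier_mat d d" "diagonal_mat A" "v \<in> carrier_vec d" "i < d"
  shows "(A *\<^sub>v v) $ i = A $$ (i, i) * v $ i"
proof -
  have "(A *\<^sub>v v) $ i = (\<Sum>j\<in>{0..<d}. A $$ (i, j) * v $ j)"
    using assms by (simp add: scalar_prod_def)
  also have "\<dots> = (\<Sum>j\<in>{0..<d}. if j = i then A $$ (i, i) * v $ i else 0)"
    using assms by (intro sum.cong) (auto simp: diagonal_mat_def)
  finally show ?thesis using assms by simp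
qed

lemma ema_iter_carrier:
  assumes "A \<in> carrier_mat d d" "C \<in> carrier_mat d d" "\<mu> \<in> carrier_vec d"
    and "\<theta>\<^sub>0 \<in> carrier_vec d" "m\<^sub>0 \<in> carrier_vec d" "\<And>k. x k \<in> carrier_vec d"
  shows "fst (ema_iter A \<mu> \<eta> C \<beta> \<theta>\<^sub>0 m\<^sub>0 x n) \<in> carrier_vec d \<and>
         snd (ema_iter A \<mu> \<eta> C \<beta> \<theta>\<^sub>0 m\<^sub>0 x n) \<in> carrier_vec d"
  using assms
  by (induction n) (auto simp: stoch_grad_def split_beta Let_def intro!: add_carrier_vec)

text \<open>Diagonal \<open>A\<close> and \<open>C\<close> do not mix coordinates, so each
  coordinate follows a scalar recursion. The average takes in the iterate already updated.\<close>

lemma ema_iter_diagonal_index: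
  fixes \<eta> \<beta> :: real
  assumes "A \<in> carrier_mat d d" "diagonal_mat A" "C \<in> carrier_mat d d" "diagonal_mat C"
    and "\<mu> \<in> carrier_vec d" "\<theta>\<^sub>0 \<in> carrier_vec d" "m\<^sub>0 \<in> carrier_vec d"
    and "\<And>k. x k \<in> carrier_vec d" and "i < d"
  defines "\<theta> \<equiv> \<lambda>n. fst (ema_iter A \<mu> \<eta> C \<beta> \<theta>\<^sub>0 m\<^sub>0 x n) $ i"
    and "m \<equiv> \<lambda>n. snd (ema_iter A \<mu> \<eta> C \<beta> \<theta>\<^sub>0 m\<^sub>0 x n) $ i"
  shows "\<theta> (Suc n) = \<theta> n - \<eta> * (A $$ (i, i) * (\<theta> n - \<mu> $ i) + x n $ i) + C $$ (i, i) * (m n - \<theta> n)"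
    and "m (Suc n) = (1 - \<beta>) * m n + \<beta> * \<theta> (Suc n)"
proof -
  obtain t z where tz: "ema_iter A \<mu> \<eta> C \<beta> \<theta>\<^sub>0 m\<^sub>0 x n = (t, z)" by fastforce
  have [simp]: "t \<in> carrier_vec d" "z \<in> carrier_vec d"
    using ema_iter_carrier[of A d C \<mu> \<theta>\<^sub>0 m\<^sub>0 x \<eta> \<beta> n] assms tz by auto
  have x [simp]: "x n \<in> carrier_vec d" by fact
  have [simp]: "dim_vec t = d" "dim_vec z = d" "dim_vec \<mu> = d" "dim_vec (x n) = d"
      "dim_row A = d" "dim_row C = d"
    using assms(1-5) x by (auto simp del: x)
  \<comment> \<open>These replace \<open>index_mult_mat_vec\<close>, which is disabled below because
    it would turn the products into scalar products with matrix rows.\<close>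
  have [simp]: "(A *\<^sub>v (t - \<mu>)) $ i = A $$ (i, i) * (t - \<mu>) $ i"
      "(C *\<^sub>v (z - t)) $ i = C $$ (i, i) * (z - t) $ i"
    using assms(1-5) \<open>i < d\<close>
    by (simp_all only: diagonal_mult_vec_index[of _ d] minus_carrier_vec
        \<open>t \<in> carrier_vec d\<close> \<open>z \<in> carrier_vec d\<close>)
  show "\<theta> (Suc n) = \<theta> n - \<eta> * (A $$ (i, i) * (\<theta> n - \<mu> $ i) + x n $ i) + C $$ (i, i) * (m n - \<theta> n)"
    and "m (Suc n) = (1 - \<beta>) * m n + \<beta> * \<theta> (Suc n)"
    using \<open>i < d\<close> tz by (simp_all add: \<theta>_def m_def stoch_grad_def Let_def del: index_mult_mat_vec)
qed

section \<open>Rademacher noise\<close>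

lemma measurable_vec_borel_index: "i < d \<Longrightarrow> (\<lambda>v. v $ i) \<in> borel_measurable (vec_borel d)"
  using measurable_vec_borel_iff[of "\<lambda>v. v" "vec_borel d" d] by simp

text \<open>Uniform signs, embedded as one-dimensional vectors so that they live on the
  sigma-algebra \<open>vec_borel 1\<close> that \<open>gradient_noise\<close> asks for.\<close>

definition rademacher :: "real vec measure" where
  "rademacher = distr (measure_pmf (pmf_of_set {-1, 1})) (vec_borel 1) (\<lambda>x. vec 1 (\<lambda>_. x))"

text \<open>A sample point is the noise sequence itself; the coordinate projections serve as the
  noise.\<close>

definition rademacher_seq :: "(nat \<Rightarrow> real vec) measure" where
  "rademacher_seq = Pi\<^sub>M UNIV (\<lambda>_. rademacher)"

lemma vec_measurable: "(\<lambda>x::real. vec 1 (\<lambda>_. x)) \<in> measurable (measure_pmf p) (vec_borel 1)"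
  unfolding measurable_vec_borel_iff by simp

lemma sets_rademacher [measurable_cong]: "sets rademacher = sets (vec_borel 1)"
  by (simp add: rademacher_def)

lemma space_rademacher: "space rademacher = carrier_vec 1"
  by (simp add: rademacher_def vec_borel_def)

lemma prob_space_rademacher: "prob_space rademacher"
  unfolding rademacher_def by (intro measure_pmf.prob_space_distr vec_measurable)

lemma prob_space_rademacher_seq: "prob_space rademacher_seq"
  unfolding rademacher_seq_def by (intro prob_space_PiM prob_space_rademacher)

lemma rademacher_seq_carrier: "\<omega> \<in> space rademacher_seq \<Longrightarrow> \<omega> k \<in> carrier_vec 1"
  by (auto simp: rademacher_seq_def space_PiM PiE_iff space_rademacher)

lemma coordinate_measurable: "(\<lambda>\<omega>. \<omega> k) \<in> measurable rademacher_seq (vec_borel 1)"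
proof -
  have "(\<lambda>\<omega>. \<omega> k) \<in> measurable rademacher_seq rademacher"
    unfolding rademacher_seq_def by (intro measurable_component_singleton) simp
  then show ?thesis by (simp cong: measurable_cong_sets add: sets_rademacher)
qed

lemma coordinate_distr: "distr rademacher_seq (vec_borel 1) (\<lambda>\<omega>. \<omega> k) = rademacher"
proof -
  have "distr rademacher_seq (vec_borel 1) (\<lambda>\<omega>. \<omega> k) = distr rademacher_seq rademacher (\<lambda>\<omega>. \<omega> k)"
    by (intro distr_cong) (simp_all add: sets_rademacher)
  then show ?thesis
    unfolding rademacher_seq_def
    using distr_PiM_component[of UNIV "\<lambda>_. rademacher" k] prob_space_rademacher by simp
qed

text \<open>Pushing forward along a coordinate and then along the embedding reduces the integral to
  a two-point average. The identity and the square for \<open>f\<close> give mean zero and variance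
  one.\<close>

lemma rademacher_integral:
  fixes f :: "real \<Rightarrow> real"
  assumes f [measurable]: "f \<in> borel_measurable borel"
  shows "integrable rademacher_seq (\<lambda>\<omega>. f (\<omega> k $ 0))"
    and "(\<integral>\<omega>. f (\<omega> k $ 0) \<partial>rademacher_seq) = (f (-1) + f 1) / 2"
proof -
  have g: "(\<lambda>v. f (v $ 0)) \<in> borel_measurable (vec_borel 1)"
    using measurable_compose[OF measurable_vec_borel_index f] by simp
  have "integrable rademacher (\<lambda>v. f (v $ 0))"
    unfolding rademacher_def
    by (subst integrable_distr_eq[OF vec_measurable g])
      (simp add: integrable_measure_pmf_finite)
  then have "integrable (distr rademacher_seq (vec_borel 1) (\<lambda>\<omega>. \<omega> k)) (\<lambda>v. f (v $ 0))"
    by (simp only: coordinate_distr)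
  then show "integrable rademacher_seq (\<lambda>\<omega>. f (\<omega> k $ 0))"
    by (simp only: integrable_distr_eq[OF coordinate_measurable g])
  have "(\<integral>\<omega>. f (\<omega> k $ 0) \<partial>rademacher_seq) = (\<integral>v. f (v $ 0) \<partial>rademacher)"
    by (subst coordinate_distr[symmetric, of k]) (simp only: integral_distr[OF coordinate_measurable g])
  also have "\<dots> = (\<integral>x. f x \<partial>measure_pmf (pmf_of_set {-1, 1}))"
    unfolding rademacher_def by (subst integral_distr[OF vec_measurable g]) simp
  also have "\<dots> = (f (-1) + f 1) / 2"
    by (subst integral_pmf_of_set) auto
  finally show "(\<integral>\<omega>. f (\<omega> k $ 0) \<partial>rademacher_seq) = (f (-1) + f 1) / 2" .
qed

text \<open>Independence means that the joint law is the product of the marginals. The joint law of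
  all coordinates is the law of the identity map, hence \<open>rademacher_seq\<close>, a product by
  construction.\<close>

lemma rademacher_indep:
  "prob_space.indep_vars rademacher_seq (\<lambda>_. vec_borel 1) (\<lambda>k \<omega>. \<omega> k) (UNIV :: nat set)"
proof -
  interpret prob_space rademacher_seq by (rule prob_space_rademacher_seq)
  have "distr rademacher_seq (Pi\<^sub>M UNIV (\<lambda>_. vec_borel 1)) (\<lambda>\<omega>. \<lambda>k\<in>UNIV. \<omega> k) = rademacher_seq"
    by (simp only: restrict_UNIV, rule distr_id2)
      (auto simp: rademacher_seq_def sets_rademacher simp del: One_nat_def intro!: sets_PiM_cong)
  then show ?thesis
    by (subst indep_vars_iff_distr_eq_PiM)
      (simp_all add: coordinate_measurable coordinate_distr rademacher_seq_def[symmetric]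
        del: One_nat_def)
qed

lemma rademacher_gradient_noise: "gradient_noise 1 rademacher_seq (\<lambda>k \<omega>. \<omega> k)"
proof -
  have cov: "cov_mat rademacher_seq 1 (\<lambda>\<omega>. \<omega> k) = mat 1 1 (\<lambda>_. 1)" for k
    using rademacher_integral(2)[of "\<lambda>x. x" k] rademacher_integral(2)[of "\<lambda>x. x * x" k]
    by (intro eq_matI) (simp_all add: cov_mat_def)
  have "mat 1 1 (\<lambda>_. 1) $$ (0, 0) \<noteq> (0\<^sub>m 1 1 :: real mat) $$ (0, 0)" by simp
  then have "mat 1 1 (\<lambda>_. 1) \<noteq> (0\<^sub>m 1 1 :: real mat)" by metis
  then show ?thesis
    using rademacher_integral[of "\<lambda>x. x"] rademacher_integral[of "\<lambda>x. x\<^sup>2"]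
    by (simp add: gradient_noise_def prob_space_rademacher_seq rademacher_indep coordinate_distr
        cov diagonal_mat_def del: One_nat_def)
qed

text \<open>Independence turns the expectation of the product over \<open>{j, k}\<close> into a
  product of means, which are zero.\<close>

lemma gradient_noise_uncorrelated:
  assumes noise: "gradient_noise d M \<xi>" and "j \<noteq> k" "i < d"
  shows "(\<integral>\<omega>. \<xi> j \<omega> $ i * \<xi> k \<omega> $ i \<partial>M) = 0"
proof -
  interpret prob_space M using noise by (simp add: gradient_noise_def)
  have "indep_vars (\<lambda>_. borel) (\<lambda>k \<omega>. \<xi> k \<omega> $ i) UNIV"
    using noise \<open>i < d\<close>
    by (intro indep_vars_compose2[where Y="\<lambda>_ v. v $ i"])
      (auto simp: gradient_noise_def measurable_vec_borel_index)
  then have "indep_vars (\<lambda>_. borel) (\<lambda>k \<omega>. \<xi> k \<omega> $ i) {j, k}"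
    by (rule indep_vars_subset) simp
  then have "expectation (\<lambda>\<omega>. \<Prod>l\<in>{j, k}. \<xi> l \<omega> $ i) = (\<Prod>l\<in>{j, k}. expectation (\<lambda>\<omega>. \<xi> l \<omega> $ i))"
    using noise \<open>i < d\<close>
    by (intro indep_vars_lebesgue_integral) (auto simp: gradient_noise_def)
  then show ?thesis using noise assms by (simp add: gradient_noise_def)
qed

section \<open>The scalar problem\<close>

lemma vec_norm_sq_1: "v \<in> carrier_vec 1 \<Longrightarrow> (vec_norm v)\<^sup>2 = v $ 0 * v $ 0"
  by (simp add: vec_norm_def L2_set_def power2_eq_square)

lemma quadratic_problem_1:
  assumes "a > 0"
  shows "quadratic_problem 1 (\<lambda>\<theta>. 1/2 * ((\<theta> - 0\<^sub>v 1) \<bullet> (mat 1 1 (\<lambda>_. a) *\<^sub>v (\<theta> - 0\<^sub>v 1))))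
    (mat 1 1 (\<lambda>_. a)) (0\<^sub>v 1)"
proof -
  have "v \<bullet> (mat 1 1 (\<lambda>_. a) *\<^sub>v v) > 0" if v: "v \<in> carrier_vec 1" "v \<noteq> 0\<^sub>v 1" for v
  proof -
    have "v $ 0 \<noteq> 0" using v by (auto simp: vec_eq_iff)
    then have "a * (v $ 0)\<^sup>2 > 0" using assms by simp
    then show ?thesis using v by (simp add: scalar_prod_def power2_eq_square mult_ac)
  qed
  then show ?thesis
    by (auto simp: quadratic_problem_def positive_definite_def diagonal_mat_def intro!: eq_matI)
qed

text \<open>Inserting the new iterate into the averaging step expresses both updates through the old
  pair, for step size 1 and minimiser 0. The choice \<open>c = 1 - a\<close> removes the old iterate
  from both updates, and \<open>c = 0\<close> makes the system triangular.\<close>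

lemma rademacher_linear_pair:
  fixes a c \<beta> :: real
  assumes "\<theta>\<^sub>0 \<in> carrier_vec 1" "m\<^sub>0 \<in> carrier_vec 1"
  defines "E \<equiv> \<lambda>\<omega>. ema_iter (mat 1 1 (\<lambda>_. a)) (0\<^sub>v 1) 1 (mat 1 1 (\<lambda>_. c)) \<beta> \<theta>\<^sub>0 m\<^sub>0 (\<lambda>k. \<omega> k)"
  shows "linear_pair rademacher_seq (\<lambda>n \<omega>. fst (E \<omega> n) $ 0) (\<lambda>n \<omega>. snd (E \<omega> n) $ 0)
    (\<lambda>k \<omega>. \<omega> k $ 0) (\<theta>\<^sub>0 $ 0) (m\<^sub>0 $ 0)
    (1 - a - c) c (-1) (\<beta> * (1 - a - c)) (1 - \<beta> + \<beta> * c) (- \<beta>)"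
proof -
  interpret prob_space rademacher_seq by (rule prob_space_rademacher_seq)
  note step = ema_iter_diagonal_index[of "mat 1 1 (\<lambda>_. a)" 1 "mat 1 1 (\<lambda>_. c)" "0\<^sub>v 1" \<theta>\<^sub>0 m\<^sub>0 _ 0 1 \<beta>]
  have X: "fst (E \<omega> (Suc k)) $ 0 = (1 - a - c) * fst (E \<omega> k) $ 0 + c * snd (E \<omega> k) $ 0 + (-1) * \<omega> k $ 0"
    and Y: "snd (E \<omega> (Suc k)) $ 0 = (1 - \<beta>) * snd (E \<omega> k) $ 0 + \<beta> * fst (E \<omega> (Suc k)) $ 0"
    if "\<omega> \<in> space rademacher_seq" for \<omega> k
    using step[of \<omega> k] rademacher_seq_carrier[OF that] assms
    by (simp_all add: E_def diagonal_mat_def algebra_simps del: ema_iter.simps)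
  show ?thesis
  proof
    show "(\<lambda>\<omega>. \<omega> k $ 0) \<in> borel_measurable rademacher_seq" for k
      using measurable_compose[OF coordinate_measurable measurable_vec_borel_index] by simp
    show "expectation (\<lambda>\<omega>. \<omega> j $ 0 * \<omega> k $ 0) = 0" if "j \<noteq> k" for j k
      using gradient_noise_uncorrelated[OF rademacher_gradient_noise that, of 0] by simp
    show "snd (E \<omega> (Suc k)) $ 0 = \<beta> * (1 - a - c) * fst (E \<omega> k) $ 0 +
        (1 - \<beta> + \<beta> * c) * snd (E \<omega> k) $ 0 + (- \<beta>) * \<omega> k $ 0"
      if "\<omega> \<in> space rademacher_seq" for \<omega> k
      unfolding Y[OF that] X[OF that] by (simp add: algebra_simps)
  qed (use X rademacher_integral[of "\<lambda>x. x"] rademacher_integral[of "\<lambda>x. x\<^sup>2"] in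
      \<open>simp_all add: E_def del: ema_iter.simps(2)\<close>)
qed

text \<open>In dimension one with minimiser 0 the squared norm is the square of the only coordinate,
  so the error is \<open>EYY\<close>. Outside its locale \<open>EYY\<close> takes only the measure
  and the second process as arguments.\<close>

lemma has_limiting_sq_error_1I:
  assumes lim: "\<And>\<theta>\<^sub>0 m\<^sub>0. \<theta>\<^sub>0 \<in> carrier_vec 1 \<Longrightarrow> m\<^sub>0 \<in> carrier_vec 1 \<Longrightarrow>
    linear_pair.EYY rademacher_seq (\<lambda>n \<omega>. snd (ema_iter (mat 1 1 (\<lambda>_. a)) (0\<^sub>v 1) 1
      (mat 1 1 (\<lambda>_. c)) \<beta> \<theta>\<^sub>0 m\<^sub>0 (\<lambda>k. \<omega> k) n) $ 0) \<longlonglongrightarrow> L"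
  shows "has_limiting_sq_error 1 rademacher_seq (\<lambda>k \<omega>. \<omega> k) (mat 1 1 (\<lambda>_. a)) (0\<^sub>v 1) 1
    (mat 1 1 (\<lambda>_. c)) \<beta> L"
  unfolding has_limiting_sq_error_def
proof (intro ballI)
  fix \<theta>\<^sub>0 m\<^sub>0 :: "real vec"
  assume init: "\<theta>\<^sub>0 \<in> carrier_vec 1" "m\<^sub>0 \<in> carrier_vec 1"
  let ?E = "\<lambda>\<omega>. ema_iter (mat 1 1 (\<lambda>_. a)) (0\<^sub>v 1) 1 (mat 1 1 (\<lambda>_. c)) \<beta> \<theta>\<^sub>0 m\<^sub>0 (\<lambda>k. \<omega> k)"
  have "(vec_norm (snd (?E \<omega> n) - 0\<^sub>v 1))\<^sup>2 = snd (?E \<omega> n) $ 0 * snd (?E \<omega> n) $ 0"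
    if "\<omega> \<in> space rademacher_seq" for \<omega> n
    using ema_iter_carrier[of "mat 1 1 (\<lambda>_. a)" 1 "mat 1 1 (\<lambda>_. c)" "0\<^sub>v 1" \<theta>\<^sub>0 m\<^sub>0 \<omega> 1 \<beta> n]
      rademacher_seq_carrier[OF that] init by (simp add: vec_norm_sq_1)
  then show "(\<lambda>T. \<integral>\<omega>. (vec_norm (ema_estimator (mat 1 1 (\<lambda>_. a)) (0\<^sub>v 1) 1 (mat 1 1 (\<lambda>_. c)) \<beta>
      \<theta>\<^sub>0 m\<^sub>0 (\<lambda>k. \<omega> k) T - 0\<^sub>v 1))\<^sup>2 \<partial>rademacher_seq) \<longlonglongrightarrow> L"
    using lim[OF init]
    by (simp add: ema_estimator_def linear_pair.EYY_def[OF rademacher_linear_pair[OF init]]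
        cong: Bochner_Integration.integral_cong del: One_nat_def)
qed

section \<open>Limiting errors with and without the pull towards the average\<close>

lemma limiting_sq_error_averaged:
  assumes "0 < \<delta>" "\<delta> < 1"
  shows "has_limiting_sq_error 1 rademacher_seq (\<lambda>k \<omega>. \<omega> k) (mat 1 1 (\<lambda>_. \<delta>)) (0\<^sub>v 1) 1
    (mat 1 1 (\<lambda>_. 1 - \<delta>)) \<delta> (1 / (2 - \<delta>\<^sup>2))"
proof (rule has_limiting_sq_error_1I)
  fix \<theta>\<^sub>0 m\<^sub>0 :: "real vec"
  assume "\<theta>\<^sub>0 \<in> carrier_vec 1" "m\<^sub>0 \<in> carrier_vec 1"
  note lp = rademacher_linear_pair[OF this, of \<delta> "1 - \<delta>" \<delta>]
  have "0 < \<delta>\<^sup>2" "\<delta>\<^sup>2 < 1" using assms by (simp_all add: power_less_one_iff)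
  moreover have b': "1 - \<delta> + \<delta> * (1 - \<delta>) = 1 - \<delta>\<^sup>2" by (simp add: power2_eq_square algebra_simps)
  \<comment> \<open>The factor \<open>\<delta>\<^sup>2\<close> cancels against the squared noise
    coefficient \<open>(- \<delta>)\<^sup>2\<close>, which keeps the limit bounded as \<delta> tends
    to 0.\<close>
  moreover have "1 - (1 - \<delta>\<^sup>2)\<^sup>2 = \<delta>\<^sup>2 * (2 - \<delta>\<^sup>2)" by (simp add: power2_eq_square algebra_simps)
  ultimately show "linear_pair.EYY rademacher_seq (\<lambda>n \<omega>. snd (ema_iter (mat 1 1 (\<lambda>_. \<delta>)) (0\<^sub>v 1) 1
      (mat 1 1 (\<lambda>_. 1 - \<delta>)) \<delta> \<theta>\<^sub>0 m\<^sub>0 (\<lambda>k. \<omega> k) n) $ 0) \<longlonglongrightarrow> 1 / (2 - \<delta>\<^sup>2)"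
    using linear_pair.EYY_tendsto_autonomous[OF lp, unfolded b'] by simp
qed

text \<open>This is the triangular case with \<open>a = b' = r\<close>,
  \<open>a' = \<delta> * r\<close>, \<open>s = -1\<close> and \<open>s' = - \<delta>\<close>, where
  \<open>r = 1 - \<delta>\<close>.\<close>

lemma limiting_sq_error_sgd:
  assumes "0 < \<delta>" "\<delta> < 1"
  shows "has_limiting_sq_error 1 rademacher_seq (\<lambda>k \<omega>. \<omega> k) (mat 1 1 (\<lambda>_. \<delta>)) (0\<^sub>v 1) 1
    (mat 1 1 (\<lambda>_. 0)) \<delta> ((1 + (1 - \<delta>)\<^sup>2) / (\<delta> * (2 - \<delta>) ^ 3))"
proof (rule has_limiting_sq_error_1I)
  fix \<theta>\<^sub>0 m\<^sub>0 :: "real vec"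
  assume "\<theta>\<^sub>0 \<in> carrier_vec 1" "m\<^sub>0 \<in> carrier_vec 1"
  note lp = rademacher_linear_pair[OF this, of \<delta> 0 \<delta>]
  define r u where "r = 1 - \<delta>" and "u = 1 / (\<delta> * (2 - \<delta>))"
  have pos: "\<delta> * (2 - \<delta>) > 0" using assms by simp
  have r: "1 - r * r = \<delta> * (2 - \<delta>)" by (simp add: r_def algebra_simps)
  then have ru: "1 / (1 - r * r) = u" by (simp add: u_def)
  have "(1 - r * r) * u = 1"
    using pos unfolding r u_def
    by (metis less_irrefl mult_1_right nonzero_mult_div_cancel_left times_divide_eq_right)
  \<comment> \<open>Stationarity of the variance \<open>u\<close> of the plain iterates. All
    simplifications below rest on this identity, used in either direction.\<close>
  then have rru: "r * r * u + 1 = u" by (simp add: algebra_simps)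
  \<comment> \<open>The limit of \<open>EXY\<close>, the mixed moment of iterate and
    average.\<close>
  have v: "(r * (\<delta> * r) * u + \<delta>) / (1 - r * r) = \<delta> * u * u"
  proof -
    have "r * (\<delta> * r) * u + \<delta> = \<delta> * (r * r * u + 1)" by (simp add: algebra_simps)
    then show ?thesis using rru by (simp add: u_def r)
  qed
  have "((\<delta> * r)\<^sup>2 * u + 2 * (\<delta> * r) * r * (\<delta> * u * u) + \<delta>\<^sup>2) = \<delta>\<^sup>2 * ((r * r * u + 1) + 2 * (r * r) * u * u)"
    by (simp add: power2_eq_square algebra_simps)
  also have "\<dots> = \<delta>\<^sup>2 * u * (r * r * u + (r * r * u + 1))"
    unfolding rru[THEN arg_cong, of "\<lambda>t. \<delta>\<^sup>2 * (t + 2 * (r * r) * u * u)"]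
    by (simp add: algebra_simps)
  also have "\<dots> = \<delta>\<^sup>2 * u * u * (1 + r\<^sup>2)"
    unfolding rru by (simp add: power2_eq_square algebra_simps)
  also have "\<dots> = (\<delta> * u) * (\<delta> * u) * (1 + r\<^sup>2)" by (simp add: power2_eq_square mult_ac)
  \<comment> \<open>Uses \<open>\<delta> * u = 1 / (2 - \<delta>)\<close>.\<close>
  also have "\<dots> = 1 / (2 - \<delta>) * (1 / (2 - \<delta>)) * (1 + r\<^sup>2)"
    using assms by (simp add: u_def)
  finally have "((\<delta> * r)\<^sup>2 * u + 2 * (\<delta> * r) * r * (\<delta> * u * u) + \<delta>\<^sup>2) / (1 - r * r) =
      (1 + r\<^sup>2) / (\<delta> * (2 - \<delta>) ^ 3)"
    unfolding r by (simp add: power3_eq_cube mult_ac)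
  \<comment> \<open>Restores the signs and the nested fractions that instantiating
    \<open>EYY_tendsto_triangular\<close> produces, so that the two expressions match.\<close>
  then have "((\<delta> * r)\<^sup>2 * ((-1)\<^sup>2 / (1 - r\<^sup>2))
      + 2 * (\<delta> * r) * r * ((r * (\<delta> * r) * ((-1)\<^sup>2 / (1 - r\<^sup>2)) + (-1) * (- \<delta>)) / (1 - r * r))
      + (- \<delta>)\<^sup>2) / (1 - r\<^sup>2) = (1 + r\<^sup>2) / (\<delta> * (2 - \<delta>) ^ 3)"
    by (simp only: power2_eq_square[of r] power2_minus power_one ru mult_minus1 minus_minus v)
  moreover have coeffs: "1 - \<delta> - 0 = r" "1 - \<delta> + \<delta> * 0 = r" by (simp_all add: r_def)
  moreover have "\<bar>r\<bar> < 1" using assms by (simp add: r_def)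
  ultimately show "linear_pair.EYY rademacher_seq (\<lambda>n \<omega>. snd (ema_iter (mat 1 1 (\<lambda>_. \<delta>)) (0\<^sub>v 1) 1
      (mat 1 1 (\<lambda>_. 0)) \<delta> \<theta>\<^sub>0 m\<^sub>0 (\<lambda>k. \<omega> k) n) $ 0)
      \<longlonglongrightarrow> (1 + (1 - \<delta>)\<^sup>2) / (\<delta> * (2 - \<delta>) ^ 3)"
    using linear_pair.EYY_tendsto_triangular[OF lp, unfolded coeffs]
    unfolding r_def[symmetric] by simp_all
qed

section \<open>Choice of \<delta> and comparison of the two limits\<close>

theorem proposition3:
  fixes \<epsilon> :: real
  assumes "\<epsilon> > 0"
  shows "\<exists>(d :: nat) (F :: real vec \<Rightarrow> real) (A :: real mat) (\<mu> :: real vec)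
            (M :: (nat \<Rightarrow> real vec) measure) (\<xi> :: nat \<Rightarrow> (nat \<Rightarrow> real vec) \<Rightarrow> real vec)
            (\<eta> :: real) (C :: real mat) (\<beta> :: real) (L :: real) (L\<^sub>S\<^sub>G\<^sub>D :: real).
           quadratic_problem d F A \<mu> \<and>
           gradient_noise d M \<xi> \<and>
           \<eta> > 0 \<and>
           C \<in> carrier_mat d d \<and> diagonal_mat C \<and> (\<forall>i<d. \<forall>j<d. C $$ (i, j) \<in> {0..1}) \<and>
           0 < \<beta> \<and> \<beta> < 1 \<and>
           has_limiting_sq_error d M \<xi> A \<mu> \<eta> C \<beta> L \<and>
           has_limiting_sq_error d M \<xi> A \<mu> \<eta> (0\<^sub>m d d) \<beta> L\<^sub>S\<^sub>G\<^sub>D \<and>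
           L \<le> \<epsilon> * L\<^sub>S\<^sub>G\<^sub>D"
proof -
  \<comment> \<open>The averaged error is at most 1 and the SGD error at least
    \<open>1 / (8 * \<delta>)\<close>, so the ratio is at most \<open>8 * \<delta>\<close>, hence
    the bound \<open>\<epsilon> / 8\<close>. The cap \<open>1/2\<close> keeps \<delta> below
    1.\<close>
  define \<delta> where "\<delta> = min (1/2) (\<epsilon> / 8)"
  have \<delta>: "0 < \<delta>" "\<delta> \<le> 1/2" "8 * \<delta> \<le> \<epsilon>" using assms by (auto simp: \<delta>_def)
  then have \<delta>1: "\<delta> < 1" by simp
  let ?A = "mat 1 1 (\<lambda>_. \<delta>)" and ?C = "mat 1 1 (\<lambda>_. 1 - \<delta>)"
  let ?L = "1 / (2 - \<delta>\<^sup>2)" and ?S = "(1 + (1 - \<delta>)\<^sup>2) / (\<delta> * (2 - \<delta>) ^ 3)"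
  have zero: "mat 1 1 (\<lambda>_. 0) = (0\<^sub>m 1 1 :: real mat)" by (intro eq_matI) auto
  have "\<delta>\<^sup>2 \<le> 1" using \<delta> by (simp add: power_le_one)
  then have "?L \<le> 1" by simp
  also have "1 \<le> \<epsilon> * (1 / (8 * \<delta>))" using \<delta> by simp
  also have "\<dots> \<le> \<epsilon> * ?S"
  proof (rule mult_left_mono)
    \<comment> \<open>The numerator of \<open>?S\<close> is at least 1 and its denominator at most
      \<open>8 * \<delta>\<close>.\<close>
    have "(2 - \<delta>) ^ 3 \<le> 2 ^ 3" using \<delta> by (intro power_mono) auto
    then show "1 / (8 * \<delta>) \<le> ?S" using \<delta> by (intro frac_le) auto
  qed (use assms in simp)
  finally have "?L \<le> \<epsilon> * ?S" .
  note facts = this quadratic_problem_1[OF \<delta>(1)] rademacher_gradient_noise \<delta>(1) \<delta>1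
    limiting_sq_error_averaged[OF \<delta>(1) \<delta>1] limiting_sq_error_sgd[OF \<delta>(1) \<delta>1, unfolded zero]
  have "diagonal_mat ?C" "\<forall>i<1. \<forall>j<1. ?C $$ (i, j) \<in> {0..1}" "?C \<in> carrier_mat 1 1" "(1 :: real) > 0"
    using \<delta> by (simp_all add: diagonal_mat_def)
  note facts = this facts
  show ?thesis
    by (rule exI[of _ 1], rule exI[of _ "\<lambda>\<theta>. 1/2 * ((\<theta> - 0\<^sub>v 1) \<bullet> (?A *\<^sub>v (\<theta> - 0\<^sub>v 1)))"],
        rule exI[of _ ?A], rule exI[of _ "0\<^sub>v 1"], rule exI[of _ rademacher_seq],
        rule exI[of _ "\<lambda>k \<omega>. \<omega> k"], rule exI[of _ 1], rule exI[of _ ?C], rule exI[of _ \<delta>],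
        rule exI[of _ ?L], rule exI[of _ ?S], intro conjI) (rule facts)+
qed

end
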